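(* Let $\lambda$ be a nonzero real number. For integers $n,r\ge0$ define $$S_n(x,r\mid\lambda)=\sum_{k=0}^{n}(-1)^k\binom{x}{k}(k)_{r,\lambda}.$$ Then for every positive integer $r$ and every integer $n\ge1$, $$ S_{n}(x,r\mid\lambda)=-x\sum_{j=0}^{r-1}\binom{r-1}{j}(1-\lambda)_{r-1-j,\lambda}\,S_{n-1}(x-1,j\mid\lambda). $$
   Context: For a real parameter $\mu$ the degenerate falling factorials are $(x)_{0,\mu}=1$ and $(x)_{n,\mu}=x(x-\mu)\cdots(x-(n-1)\mu)$ for $n\ge1$; $(x)_n=(x)_{n,1}$ is the usual falling factorial, and $\binom{x}{m}=(x)_m/m!$ for integers $m\ge0$. *)

theory Defs
  imports Complex_Main
begin

definition degen_ffact :: "real \<Rightarrow> real \<Rightarrow> nat \<Rightarrow> real" where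
  "degen_ffact \<mu> x n = (\<Prod>i<n. x - real i * \<mu>)"

text \<open>The binomial coefficient with real upper argument is the library's \<open>gchoose\<close>, which over
  the reals is by definition the falling factorial divided by \<open>fact\<close>.\<close>

definition S_sum :: "nat \<Rightarrow> real \<Rightarrow> nat \<Rightarrow> real \<Rightarrow> real" where
  "S_sum n x r lam = (\<Sum>k=0..n. (-1) ^ k * (x gchoose k) * degen_ffact lam (real k) r)"

end

theory Submission
  imports Defs
begin

text \<open>Write $(k)_{r,\lambda} = k\,(k-\lambda)_{r-1,\lambda}$ and absorb the factor $k$ by
  $k\binom{x}{k} = x\binom{x-1}{k-1}$. Expanding $((1-\lambda)+(k-1))_{r-1,\lambda}$ by the
  Vandermonde identity and exchanging the two sums gives the claim.\<close>

lemma degen_ffact_Suc_left: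
  "degen_ffact \<mu> x (Suc n) = x * degen_ffact \<mu> (x - \<mu>) n"
  unfolding degen_ffact_def prod.lessThan_Suc_shift by (simp add: algebra_simps)

text \<open>Pulling \<open>- \<mu>\<close> out of each factor \<open>x - i * \<mu>\<close> leaves
  \<open>- x / \<mu> + i\<close>, a factor of a rising factorial. This gives access to the
  Vandermonde identity for \<open>pochhammer\<close>.\<close>

lemma degen_ffact_eq_pochhammer:
  assumes "\<mu> \<noteq> 0"
  shows "degen_ffact \<mu> x n = (- \<mu>) ^ n * pochhammer (- x / \<mu>) n"
proof -
  have "(- \<mu>) ^ n * pochhammer (- x / \<mu>) n = (\<Prod>i<n. - \<mu> * (- x / \<mu> + real i))"
    unfolding pochhammer_prod prod.distrib by (simp add: atLeast0LessThan)
  also have "\<dots> = degen_ffact \<mu> x n"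
    unfolding degen_ffact_def using assms by (intro prod.cong) (auto simp: field_simps)
  finally show ?thesis ..
qed

text \<open>Vandermonde for \<open>pochhammer\<close>, rescaled by powers of
  \<open>- \<mu>\<close>.\<close>

lemma degen_ffact_add:
  assumes "\<mu> \<noteq> 0"
  shows "degen_ffact \<mu> (a + b) n =
    (\<Sum>j\<le>n. real (n choose j) * degen_ffact \<mu> a (n - j) * degen_ffact \<mu> b j)"
proof -
  \<comment> \<open>\<open>b\<close> comes first so that the summation index \<open>j\<close>
    becomes its degree.\<close>
  have "degen_ffact \<mu> (a + b) n = (- \<mu>) ^ n * pochhammer (- b / \<mu> + - a / \<mu>) n"
    using assms by (simp add: degen_ffact_eq_pochhammer diff_divide_distrib add.commute[of a])
  also have "\<dots> = (\<Sum>j\<le>n. (- \<mu>) ^ n *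
      (real (n choose j) * pochhammer (- b / \<mu>) j * pochhammer (- a / \<mu>) (n - j)))"
    unfolding pochhammer_binomial_sum sum_distrib_left ..
  also have "\<dots> = (\<Sum>j\<le>n. real (n choose j) * degen_ffact \<mu> a (n - j) * degen_ffact \<mu> b j)"
  proof (intro sum.cong refl)
    fix j assume "j \<in> {..n}"
    \<comment> \<open>The scaling power is shared out to match the degrees \<open>n - j\<close> and
      \<open>j\<close> of the two rising factorials.\<close>
    then have "(- \<mu>) ^ n = (- \<mu>) ^ (n - j) * (- \<mu>) ^ j"
      by (simp flip: power_add)
    then show "(- \<mu>) ^ n * (real (n choose j) * pochhammer (- b / \<mu>) j * pochhammer (- a / \<mu>) (n - j))
        = real (n choose j) * degen_ffact \<mu> a (n - j) * degen_ffact \<mu> b j"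
      unfolding degen_ffact_eq_pochhammer[OF assms] by (simp only: ac_simps)
  qed
  finally show ?thesis .
qed

theorem theorem2p8:
  fixes lam x :: real and r n :: nat
  assumes "lam \<noteq> 0" and "r \<ge> 1" and "n \<ge> 1"
  shows "S_sum n x r lam =
    - x * (\<Sum>j=0..r-1. real ((r - 1) choose j) * degen_ffact lam (1 - lam) (r - 1 - j) * S_sum (n - 1) (x - 1) j lam)"
proof -
  obtain s m where r: "r = Suc s" and n: "n = Suc m"
    using assms by (metis Suc_le_D One_nat_def)
  let ?c = "\<lambda>j. real (s choose j) * degen_ffact lam (1 - lam) (s - j)"
  let ?g = "\<lambda>k. (-1) ^ k * ((x - 1) gchoose k)"
  have "S_sum n x r lam =
      (\<Sum>k\<le>m. (-1) ^ Suc k * (x gchoose Suc k) * degen_ffact lam (real (Suc k)) (Suc s))"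
    \<comment> \<open>The term at index 0 vanishes because \<open>degen_ffact lam 0 (Suc s)\<close>
      has the factor 0; this is where \<open>r \<ge> 1\<close> matters.\<close>
    unfolding S_sum_def r n atLeast0AtMost sum.atMost_Suc_shift
    by (simp add: degen_ffact_Suc_left)
  also have "\<dots> = (\<Sum>k\<le>m. - x * (\<Sum>j\<le>s. ?c j * (?g k * degen_ffact lam (real k) j)))"
  proof (intro sum.cong refl)
    fix k
    have absorb: "real (Suc k) * (x gchoose Suc k) = x * ((x - 1) gchoose k)"
      by (rule gbinomial_absorption)
    have "(-1) ^ Suc k * (x gchoose Suc k) * degen_ffact lam (real (Suc k)) (Suc s)
        = - ((-1) ^ k) * (real (Suc k) * (x gchoose Suc k)) * degen_ffact lam (real (Suc k) - lam) s"
      unfolding degen_ffact_Suc_left by (simp only: power_Suc mult_minus_left mult_1 ac_simps)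
    \<comment> \<open>The argument \<open>Suc k - lam\<close> is regrouped as
      \<open>(1 - lam) + k\<close>: the first summand is independent of \<open>k\<close> and yields
      the coefficients \<open>?c j\<close>, the second yields the factors that occur in
      \<open>S_sum m (x - 1) j lam\<close>.\<close>
    also have "\<dots> = - x * (?g k * degen_ffact lam ((1 - lam) + real k) s)"
      unfolding absorb by (simp add: algebra_simps)
    also have "\<dots> = - x * (\<Sum>j\<le>s. ?c j * (?g k * degen_ffact lam (real k) j))"
      unfolding degen_ffact_add[OF assms(1)] sum_distrib_left by (simp only: ac_simps)
    finally show "(-1) ^ Suc k * (x gchoose Suc k) * degen_ffact lam (real (Suc k)) (Suc s)
        = - x * (\<Sum>j\<le>s. ?c j * (?g k * degen_ffact lam (real k) j))" .
  qed
  also have "\<dots> = - x * (\<Sum>j\<le>s. \<Sum>k\<le>m. ?c j * (?g k * degen_ffact lam (real k) j))"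
    \<comment> \<open>Fixing the factor \<open>- x\<close> keeps \<open>?c j\<close> inside the
      inner sum.\<close>
    by (simp only: sum_distrib_left[symmetric, of "- x"] sum.swap[of _ "{..m}"])
  also have "\<dots> = - x * (\<Sum>j\<le>s. ?c j * S_sum m (x - 1) j lam)"
    unfolding S_sum_def atLeast0AtMost sum_distrib_left ..
  finally show ?thesis
    unfolding r n by (simp add: atLeast0AtMost)
qed

end
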